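(* Let $v_1,v_2\in\mathbb{R}^2$ be linearly independent unit vectors and $\lambda_1,\lambda_2>0$. Every $(v_1,v_2)$-taxicab circle is a parallelogram with the same center, each of whose diagonals is perpendicular to $v_1$ or $v_2$. In addition, if $\lambda_1=\lambda_2$ then it is a rectangle; if $v_1\perp v_2$ then it is a rhombus; and if $\lambda_1=\lambda_2$ and $v_1\perp v_2$ then it is a square.
   Context: Write $v_i=(v_{i1},v_{i2})$. The $(v_1,v_2)$-taxicab distance (with weights $\lambda_1,\lambda_2$) between $P_1=(x_1,y_1)$ and $P_2=(x_2,y_2)$ in $\mathbb{R}^2$ is $$d_{T(v_1,v_2)}(P_1,P_2)=\lambda_1|v_{11}(x_1-x_2)+v_{12}(y_1-y_2)|+\lambda_2|v_{21}(x_1-x_2)+v_{22}(y_1-y_2)|.$$ A $(v_1,v_2)$-taxicab circle with center $C\in\mathbb{R}^2$ and radius $r>0$ is the set $\{P\in\mathbb{R}^2: d_{T(v_1,v_2)}(C,P)=r\}$. Parallelogram, rectangle, rhombus, square (meaning their boundary curves, nondegenerate) and perpendicularity are in the Euclidean sense; the center of such a figure is its center of symmetry. *)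

theory Defs
  imports "HOL-Analysis.Analysis"
begin

definition taxicab_dist ::
  "real \<Rightarrow> real \<Rightarrow> real^2 \<Rightarrow> real^2 \<Rightarrow> real^2 \<Rightarrow> real^2 \<Rightarrow> real" where
  "taxicab_dist l1 l2 v1 v2 P Q =
     l1 * \<bar>v1$1 * (P$1 - Q$1) + v1$2 * (P$2 - Q$2)\<bar> +
     l2 * \<bar>v2$1 * (P$1 - Q$1) + v2$2 * (P$2 - Q$2)\<bar>"

definition taxicab_circle ::
  "real \<Rightarrow> real \<Rightarrow> real^2 \<Rightarrow> real^2 \<Rightarrow> real^2 \<Rightarrow> real \<Rightarrow> (real^2) set" where
  "taxicab_circle l1 l2 v1 v2 Z r = {P. taxicab_dist l1 l2 v1 v2 Z P = r}"

text \<open>Figures are given by their vertices in cyclic order, so the diagonals join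
  the first vertex to the third and the second to the fourth; the figure itself, as a
  point set, is the boundary curve.\<close>

definition quadrilateral_boundary ::
  "real^2 \<Rightarrow> real^2 \<Rightarrow> real^2 \<Rightarrow> real^2 \<Rightarrow> (real^2) set" where
  "quadrilateral_boundary A B C D =
     closed_segment A B \<union> closed_segment B C \<union> closed_segment C D \<union> closed_segment D A"

text \<open>Two vectors are parallel when they are collinear with the origin. Given that the
  opposite sides are parallel, non-collinearity of three of the vertices excludes every
  degenerate case: it forces the fourth vertex to be \<open>A + C - B\<close>.\<close>

definition parallelogram :: "real^2 \<Rightarrow> real^2 \<Rightarrow> real^2 \<Rightarrow> real^2 \<Rightarrow> bool" where
  "parallelogram A B C D \<longleftrightarrow>
     \<not> collinear {A, B, C} \<and>
     collinear {0, B - A, C - D} \<and> collinear {0, C - B, D - A}"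

definition rectangle :: "real^2 \<Rightarrow> real^2 \<Rightarrow> real^2 \<Rightarrow> real^2 \<Rightarrow> bool" where
  "rectangle A B C D \<longleftrightarrow>
     parallelogram A B C D \<and>
     orthogonal (D - A) (B - A) \<and> orthogonal (A - B) (C - B) \<and>
     orthogonal (B - C) (D - C) \<and> orthogonal (C - D) (A - D)"

definition rhombus :: "real^2 \<Rightarrow> real^2 \<Rightarrow> real^2 \<Rightarrow> real^2 \<Rightarrow> bool" where
  "rhombus A B C D \<longleftrightarrow>
     parallelogram A B C D \<and>
     dist A B = dist B C \<and> dist B C = dist C D \<and> dist C D = dist D A"

definition square :: "real^2 \<Rightarrow> real^2 \<Rightarrow> real^2 \<Rightarrow> real^2 \<Rightarrow> bool" where
  "square A B C D \<longleftrightarrow> rectangle A B C D \<and> rhombus A B C D"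

definition center_of_symmetry :: "real^2 \<Rightarrow> (real^2) set \<Rightarrow> bool" where
  "center_of_symmetry Z S \<longleftrightarrow> (\<lambda>P. 2 *\<^sub>R Z - P) ` S = S"

end

theory Submission
  imports Defs
begin

text \<open>Let \<open>p, q\<close> be the basis dual to \<open>v1, v2\<close>. In the coordinates along the half-diagonals
  \<open>a = (r / l1) p\<close> and \<open>b = (r / l2) q\<close> the circle becomes the \<open>\<ell>\<^sup>1\<close> unit circle
  \<open>\<bar>s\<bar> + \<bar>t\<bar> = 1\<close>, which is the parallelogram with vertices \<open>Z \<plusminus> a\<close>, \<open>Z \<plusminus> b\<close>. Duality makes
  \<open>a\<close> orthogonal to \<open>v2\<close> and \<open>b\<close> to \<open>v1\<close>. Since \<open>v1, v2\<close> are unit vectors of the plane,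
  \<open>p\<close> and \<open>q\<close> have the same length, so equal weights give equal diagonals; and \<open>p \<bottom> q\<close>
  as soon as \<open>v1 \<bottom> v2\<close>, which gives perpendicular diagonals.\<close>

definition "l1_circle Z a b = {Z + s *\<^sub>R a + t *\<^sub>R b |s t. \<bar>s\<bar> + \<bar>t\<bar> = (1::real)}"

lemma in_closed_segment_add:
  fixes Z a b :: "'a::real_vector"
  shows "P \<in> closed_segment (Z + a) (Z + b) \<longleftrightarrow>
    (\<exists>u. 0 \<le> u \<and> u \<le> 1 \<and> P = Z + (1 - u) *\<^sub>R a + u *\<^sub>R b)"
  by (simp add: in_segment algebra_simps)

text \<open>On each sign quadrant of \<open>(s, t)\<close> the equation
  \<open>\<bar>s\<bar> + \<bar>t\<bar> = 1\<close> is linear and cuts out exactly one side.\<close>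

lemma quadrilateral_boundary_eq_l1_circle:
  "quadrilateral_boundary (Z + a) (Z + b) (Z - a) (Z - b) = l1_circle Z a b" (is "?L = ?R")
proof (intro subset_antisym subsetI)
  fix P
  assume "P \<in> ?L"
  \<comment> \<open>Writing \<open>Z - a\<close> as \<open>Z + - a\<close> makes
    \<open>in_closed_segment_add\<close> fit all four sides.\<close>
  then have "P \<in> closed_segment (Z + a) (Z + b) \<or> P \<in> closed_segment (Z + b) (Z + - a) \<or>
      P \<in> closed_segment (Z + - a) (Z + - b) \<or> P \<in> closed_segment (Z + - b) (Z + a)"
    by (auto simp: quadrilateral_boundary_def)
  then consider u where "0 \<le> u" "u \<le> 1" "P = Z + (1 - u) *\<^sub>R a + u *\<^sub>R b"
    | u where "0 \<le> u" "u \<le> 1" "P = Z + (- u) *\<^sub>R a + (1 - u) *\<^sub>R b"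
    | u where "0 \<le> u" "u \<le> 1" "P = Z + (u - 1) *\<^sub>R a + (- u) *\<^sub>R b"
    | u where "0 \<le> u" "u \<le> 1" "P = Z + u *\<^sub>R a + (u - 1) *\<^sub>R b"
    unfolding in_closed_segment_add by (force simp: algebra_simps)
  then show "P \<in> ?R"
    unfolding l1_circle_def by cases (fastforce simp: abs_if)+
next
  fix P
  assume "P \<in> ?R"
  then obtain s t where st: "\<bar>s\<bar> + \<bar>t\<bar> = 1" and P: "P = Z + s *\<^sub>R a + t *\<^sub>R b"
    by (auto simp: l1_circle_def)
  \<comment> \<open>The signs select the side; its parameter \<open>u\<close> is the absolute value
    of the coordinate along the second endpoint.\<close>
  consider "0 \<le> s" "0 \<le> t" | "s \<le> 0" "0 \<le> t" | "s \<le> 0" "t \<le> 0" | "0 \<le> s" "t \<le> 0"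
    by linarith
  then have "P \<in> closed_segment (Z + a) (Z + b) \<or> P \<in> closed_segment (Z + b) (Z + - a) \<or>
      P \<in> closed_segment (Z + - a) (Z + - b) \<or> P \<in> closed_segment (Z + - b) (Z + a)"
  proof cases
    case 1
    with st have "s = 1 - t" "t \<le> 1" by auto
    with 1 P show ?thesis unfolding in_closed_segment_add by blast
  next
    case 2
    with st have "t = 1 - (- s)" "- s \<le> 1" by auto
    with 2 P have "P \<in> closed_segment (Z + b) (Z + - a)" unfolding in_closed_segment_add
      by (intro exI[of _ "- s"]) (auto simp: algebra_simps)
    then show ?thesis by blast
  next
    case 3
    with st have "s = - (1 - (- t))" "- t \<le> 1" by auto
    with 3 P have "P \<in> closed_segment (Z + - a) (Z + - b)" unfolding in_closed_segment_add
      by (intro exI[of _ "- t"]) (auto simp: algebra_simps)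
    then show ?thesis by blast
  next
    case 4
    with st have "t = - (1 - s)" "s \<le> 1" by auto
    with 4 P have "P \<in> closed_segment (Z + - b) (Z + a)" unfolding in_closed_segment_add
      by (intro exI[of _ s]) (auto simp: algebra_simps)
    then show ?thesis by blast
  qed
  then show "P \<in> ?L"
    by (auto simp: quadrilateral_boundary_def)
qed

text \<open>Reflection in \<open>Z\<close> negates \<open>s\<close> and \<open>t\<close>, which
  preserves \<open>\<bar>s\<bar> + \<bar>t\<bar>\<close>.\<close>

lemma center_of_symmetry_l1_circle: "center_of_symmetry Z (l1_circle Z a b)"
proof -
  have sub: "2 *\<^sub>R Z - P \<in> l1_circle Z a b" if "P \<in> l1_circle Z a b" for P
  proof -
    from that obtain s t where "\<bar>s\<bar> + \<bar>t\<bar> = 1" "P = Z + s *\<^sub>R a + t *\<^sub>R b"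
      by (auto simp: l1_circle_def)
    then have "\<bar>- s\<bar> + \<bar>- t\<bar> = 1" "2 *\<^sub>R Z - P = Z + (- s) *\<^sub>R a + (- t) *\<^sub>R b"
      by (simp_all add: algebra_simps scaleR_2)
    then show ?thesis unfolding l1_circle_def by blast
  qed
  show ?thesis
    unfolding center_of_symmetry_def
  proof (intro subset_antisym subsetI)
    fix P
    assume "P \<in> l1_circle Z a b"
    \<comment> \<open>The reflection is an involution, so \<open>P\<close> is the image of its own
      reflection.\<close>
    then show "P \<in> (\<lambda>P. 2 *\<^sub>R Z - P) ` l1_circle Z a b"
      by (intro image_eqI[OF _ sub]) simp_all
  qed (use sub in auto)
qed

lemma parallelogram_diagonals:
  assumes indep: "\<And>s t. s *\<^sub>R a + t *\<^sub>R b = 0 \<Longrightarrow> s = 0 \<and> t = 0"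
  shows "parallelogram (Z + a) (Z + b) (Z - a) (Z - b)"
proof -
  have "\<not> collinear {Z + a, Z + b, Z - a}"
  proof
    assume "collinear {Z + a, Z + b, Z - a}"
    moreover have "(Z + a) - (Z + b) = a - b" "(Z - a) - (Z + b) = - a - b"
      by simp_all
    ultimately have "collinear {0, a - b, - a - b}"
      using collinear_3[of "Z + a" "Z + b" "Z - a"] by (simp add: NO_MATCH_def)
    then consider "a - b = 0" | "- a - b = 0" | c where "- a - b = c *\<^sub>R (a - b)"
      by (auto simp: collinear_lemma)
    then show False
    proof cases
      case 1
      then show False using indep[of 1 "-1"] by simp
    next
      case 2
      then show False using indep[of "-1" "-1"] by simp
    next
      case (3 c)
      \<comment> \<open>Independence would force both \<open>c = -1\<close> and
        \<open>c = 1\<close>.\<close>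
      then have "(c + 1) *\<^sub>R a + (1 - c) *\<^sub>R b = 0"
        by (simp add: algebra_simps)
      then show False using indep[of "c + 1" "1 - c"] by auto
    qed
  qed
  \<comment> \<open>Opposite sides are equal as vectors, hence the factor 1.\<close>
  moreover have "collinear {0, (Z + b) - (Z + a), (Z - a) - (Z - b)}"
    "collinear {0, (Z - a) - (Z + b), (Z - b) - (Z + a)}"
    by (auto simp: collinear_lemma intro!: exI[of _ 1])
  ultimately show ?thesis
    by (simp add: parallelogram_def)
qed

text \<open>Up to sign, adjacent sides are \<open>a - b\<close> and \<open>a + b\<close>, with inner
  product \<open>a \<bullet> a - b \<bullet> b\<close>.\<close>

lemma rectangle_diagonals:
  assumes "parallelogram (Z + a) (Z + b) (Z - a) (Z - b)" and "a \<bullet> a = b \<bullet> b"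
  shows "rectangle (Z + a) (Z + b) (Z - a) (Z - b)"
  using assms by (simp add: rectangle_def orthogonal_def algebra_simps inner_commute)

text \<open>The squared side lengths are \<open>a \<bullet> a + b \<bullet> b\<close> plus or minus
  \<open>2 * (a \<bullet> b)\<close>.\<close>

lemma rhombus_diagonals:
  assumes "parallelogram (Z + a) (Z + b) (Z - a) (Z - b)" and "a \<bullet> b = 0"
  shows "rhombus (Z + a) (Z + b) (Z - a) (Z - b)"
  using assms
  by (simp add: rhombus_def dist_norm norm_eq_sqrt_inner algebra_simps inner_commute)

lemma inner_real2: "x \<bullet> y = x$1 * y$1 + x$2 * y$2" for x y :: "real^2"
  by (simp add: inner_vec_def sum_2)

lemma taxicab_dist_inner:
  "taxicab_dist l1 l2 v1 v2 P Q = l1 * \<bar>v1 \<bullet> (P - Q)\<bar> + l2 * \<bar>v2 \<bullet> (P - Q)\<bar>"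
  by (simp add: taxicab_dist_def inner_real2)

text \<open>With zero determinant, \<open>w\<close> equals its projection onto the line of the unit
  vector \<open>v\<close>. The assumption \<open>v \<noteq> w\<close> matters because
  \<open>{v, w}\<close> would otherwise collapse to an independent singleton.\<close>

lemma independent_unit_det_nonzero:
  fixes v w :: "real^2"
  assumes "norm v = 1" and "v \<noteq> w" and "independent {v, w}"
  shows "v$1 * w$2 - v$2 * w$1 \<noteq> 0"
proof
  assume det: "v$1 * w$2 - v$2 * w$1 = 0"
  have nv: "v$1 * v$1 + v$2 * v$2 = 1"
    using assms(1) by (simp add: norm_eq_1 inner_real2)
  have "w$1 = (v$1 * w$1 + v$2 * w$2) * v$1" "w$2 = (v$1 * w$1 + v$2 * w$2) * v$2"
    using det nv by algebra+
  then have "w = (v \<bullet> w) *\<^sub>R v"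
    by (simp add: vec_eq_iff forall_2 inner_real2)
  then have "w \<in> span {v}"
    by (metis span_mul span_base singletonI)
  moreover have "w \<notin> span {v}"
    using assms(2,3) independent_insert[of w "{v}"] by (simp add: insert_commute)
  ultimately show False by blast
qed

text \<open>Pairing with \<open>v1\<close> and \<open>v2\<close> reads off the coordinates along
  \<open>p\<close> and \<open>q\<close>; the factors \<open>l1 / r\<close> and \<open>l2 / r\<close>
  absorb weights and radius.\<close>

lemma taxicab_circle_eq_l1_circle:
  assumes pos: "l1 > 0" "l2 > 0" "r > 0"
    and dual: "v1 \<bullet> p = 1" "v2 \<bullet> p = 0" "v1 \<bullet> q = 0" "v2 \<bullet> q = 1"
    and expand: "\<And>w. w = (v1 \<bullet> w) *\<^sub>R p + (v2 \<bullet> w) *\<^sub>R q"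
  shows "taxicab_circle l1 l2 v1 v2 Z r = l1_circle Z ((r / l1) *\<^sub>R p) ((r / l2) *\<^sub>R q)"
proof (intro subset_antisym subsetI)
  fix P
  assume "P \<in> taxicab_circle l1 l2 v1 v2 Z r"
  then have "l1 * \<bar>v1 \<bullet> (P - Z)\<bar> + l2 * \<bar>v2 \<bullet> (P - Z)\<bar> = r"
    by (simp add: taxicab_circle_def taxicab_dist_inner inner_diff_right abs_minus_commute)
  then have "\<bar>l1 / r * (v1 \<bullet> (P - Z))\<bar> + \<bar>l2 / r * (v2 \<bullet> (P - Z))\<bar> = 1"
    using pos by (simp add: abs_mult field_simps)
  moreover have "P = Z + (l1 / r * (v1 \<bullet> (P - Z))) *\<^sub>R (r / l1) *\<^sub>R p
      + (l2 / r * (v2 \<bullet> (P - Z))) *\<^sub>R (r / l2) *\<^sub>R q"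
    using expand[of "P - Z"] pos by (simp add: algebra_simps)
  ultimately show "P \<in> l1_circle Z ((r / l1) *\<^sub>R p) ((r / l2) *\<^sub>R q)"
    unfolding l1_circle_def by blast
next
  fix P
  assume "P \<in> l1_circle Z ((r / l1) *\<^sub>R p) ((r / l2) *\<^sub>R q)"
  then obtain s t where st: "\<bar>s\<bar> + \<bar>t\<bar> = 1"
    and P: "P = Z + s *\<^sub>R (r / l1) *\<^sub>R p + t *\<^sub>R (r / l2) *\<^sub>R q"
    by (auto simp: l1_circle_def)
  have "v1 \<bullet> (Z - P) = - (s * (r / l1))" "v2 \<bullet> (Z - P) = - (t * (r / l2))"
    using dual by (simp_all add: P algebra_simps)
  then have "taxicab_dist l1 l2 v1 v2 Z P = r * (\<bar>s\<bar> + \<bar>t\<bar>)"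
    unfolding taxicab_dist_inner using pos by (simp add: abs_mult distrib_left)
  then show "P \<in> taxicab_circle l1 l2 v1 v2 Z r"
    by (simp add: taxicab_circle_def st)
qed

theorem theorem3p1:
  fixes v1 v2 Z :: "real^2" and l1 l2 r :: real
  assumes "norm v1 = 1" and "norm v2 = 1"
    and "v1 \<noteq> v2" and "independent {v1, v2}"
    and "l1 > 0" and "l2 > 0"
    and "r > 0"
  shows "\<exists>A B C D.
    taxicab_circle l1 l2 v1 v2 Z r = quadrilateral_boundary A B C D \<and>
    parallelogram A B C D \<and>
    center_of_symmetry Z (quadrilateral_boundary A B C D) \<and>
    (orthogonal (C - A) v1 \<or> orthogonal (C - A) v2) \<and>
    (orthogonal (D - B) v1 \<or> orthogonal (D - B) v2) \<and>
    (l1 = l2 \<longrightarrow> rectangle A B C D) \<and>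
    (orthogonal v1 v2 \<longrightarrow> rhombus A B C D) \<and>
    (l1 = l2 \<and> orthogonal v1 v2 \<longrightarrow> square A B C D)"
proof -
  define d where "d = v1$1 * v2$2 - v1$2 * v2$1"
  have d: "d \<noteq> 0"
    unfolding d_def using assms by (intro independent_unit_det_nonzero)
  \<comment> \<open>These are the columns of the inverse of the matrix with rows \<open>v1\<close>
    and \<open>v2\<close>.\<close>
  define p q :: "real^2"
    where "p = (1 / d) *\<^sub>R vector [v2$2, - v2$1]" and "q = (1 / d) *\<^sub>R vector [- v1$2, v1$1]"
  have dual: "v1 \<bullet> p = 1" "v2 \<bullet> p = 0" "v1 \<bullet> q = 0" "v2 \<bullet> q = 1"
    using d by (simp_all add: p_def q_def inner_real2 field_simps) (simp_all add: d_def)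
  have expand: "w = (v1 \<bullet> w) *\<^sub>R p + (v2 \<bullet> w) *\<^sub>R q" for w
  proof -
    \<comment> \<open>Cramer's rule, cleared of the denominator \<open>d\<close>.\<close>
    have "d * w$1 = (v1 \<bullet> w) * v2$2 - (v2 \<bullet> w) * v1$2"
      "d * w$2 = - ((v1 \<bullet> w) * v2$1) + (v2 \<bullet> w) * v1$1"
      by (simp_all add: d_def inner_real2 algebra_simps)
    then show ?thesis
      using d by (simp add: vec_eq_iff forall_2 p_def q_def field_simps)
  qed
  \<comment> \<open>Up to the factor \<open>1 / d\<close>, \<open>p\<close> is \<open>v2\<close> and
    \<open>q\<close> is \<open>v1\<close> after quarter turns in opposite directions; this explains
    the swapped indices and the minus sign in \<open>pq\<close>.\<close>
  have pp: "p \<bullet> p = (v2 \<bullet> v2) / d\<^sup>2" and qq: "q \<bullet> q = (v1 \<bullet> v1) / d\<^sup>2"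
    and pq: "p \<bullet> q = - (v1 \<bullet> v2) / d\<^sup>2"
    by (simp_all add: p_def q_def inner_real2 power2_eq_square algebra_simps
        diff_divide_distrib add_divide_distrib)
  define a b where "a = (r / l1) *\<^sub>R p" and "b = (r / l2) *\<^sub>R q"
  have indep: "s = 0 \<and> t = 0" if "s *\<^sub>R a + t *\<^sub>R b = 0" for s t
  proof -
    have "v1 \<bullet> (s *\<^sub>R a + t *\<^sub>R b) = s * (r / l1)" "v2 \<bullet> (s *\<^sub>R a + t *\<^sub>R b) = t * (r / l2)"
      using dual by (simp_all add: a_def b_def inner_add_right)
    then have "s * (r / l1) = 0" "t * (r / l2) = 0"
      unfolding that by simp_all
    with assms(5-7) show ?thesis by simp
  qed
  have par: "parallelogram (Z + a) (Z + b) (Z - a) (Z - b)"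
    using indep by (rule parallelogram_diagonals)
  have circle: "taxicab_circle l1 l2 v1 v2 Z r =
      quadrilateral_boundary (Z + a) (Z + b) (Z - a) (Z - b)"
    unfolding quadrilateral_boundary_eq_l1_circle a_def b_def
    using assms(5-7) dual expand by (rule taxicab_circle_eq_l1_circle)
  have center: "center_of_symmetry Z (quadrilateral_boundary (Z + a) (Z + b) (Z - a) (Z - b))"
    unfolding quadrilateral_boundary_eq_l1_circle by (rule center_of_symmetry_l1_circle)
  \<comment> \<open>The diagonals are \<open>-2 a\<close> and \<open>-2 b\<close>, multiples of
    \<open>p\<close> and \<open>q\<close>.\<close>
  have diag: "orthogonal ((Z - a) - (Z + a)) v2" "orthogonal ((Z - b) - (Z + b)) v1"
    using dual
    unfolding a_def b_def orthogonal_def inner_diff_left inner_add_left inner_scaleR_left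
    by (simp_all add: inner_commute)
  have rect: "rectangle (Z + a) (Z + b) (Z - a) (Z - b)" if "l1 = l2"
    using par
  proof (rule rectangle_diagonals)
    have "v1 \<bullet> v1 = 1" "v2 \<bullet> v2 = 1"
      using assms(1,2) by (simp_all add: norm_eq_1)
    with that show "a \<bullet> a = b \<bullet> b"
      by (simp add: a_def b_def pp qq)
  qed
  have rhomb: "rhombus (Z + a) (Z + b) (Z - a) (Z - b)" if "orthogonal v1 v2"
    using par
  proof (rule rhombus_diagonals)
    show "a \<bullet> b = 0"
      using that by (simp add: a_def b_def pq orthogonal_def)
  qed
  show ?thesis
    using circle par center diag rect rhomb unfolding square_def by blast
qed

end
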